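(* Let $n\ge2$. If $E\subset\mathbb{R}^n$ is compact and $Q$-regular for some $0<Q<n$, then there are constants $0<c<C<\infty$, depending only on the $Q$-regularity data of $E$, such that $$c\,r^{n-Q}\le m(E(r))\le C\,r^{n-Q}\qquad\text{for } 0<r<\operatorname{diam}(E).$$
   Context: $m$ is $n$-dimensional Lebesgue measure, and for $r>0$, $E(r)=\{x\in\mathbb{R}^n: d(x,E)\le r\}$. A set $E\subset\mathbb{R}^n$ is $Q$-regular ($0<Q<n$) if there is a (Borel regular, outer) measure $\mu$ with $\operatorname{spt}(\mu)=E$ (the smallest closed set of full $\mu$-measure) and constants $0<\alpha\le\beta<\infty$ such that $\alpha r^Q\le\mu(B^n(x,r))\le\beta r^Q$ for all $x\in E$ and $0<r<\operatorname{diam}(E)$, where $B^n(x,r)$ is the open Euclidean ball. The $Q$-regularity data are $n,Q,\alpha,\beta$ and $\operatorname{diam}(E)$. *)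

theory Defs
  imports "HOL-Analysis.Analysis"
begin

text \<open>
  Measures here are outer measures, defined on all subsets of the space.  The library's
  \<open>countably_subadditive\<close> speaks about disjoint families only; together with
  \<open>increasing\<close> this gives the inequality for arbitrary countable families.
\<close>

definition borel_regular_outer_measure :: "('a::topological_space set \<Rightarrow> ennreal) \<Rightarrow> bool" where
  "borel_regular_outer_measure \<mu> \<longleftrightarrow>
     outer_measure_space UNIV \<mu> \<and>
     sets borel \<subseteq> lambda_system UNIV UNIV \<mu> \<and>
     (\<forall>A. \<exists>B\<in>sets borel. A \<subseteq> B \<and> \<mu> B = \<mu> A)"

text \<open>A set has full measure when its complement is null, also if \<open>\<mu>\<close> is infinite.\<close>

definition is_spt :: "('a::topological_space set \<Rightarrow> ennreal) \<Rightarrow> 'a set \<Rightarrow> bool" where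
  "is_spt \<mu> S \<longleftrightarrow>
     closed S \<and> \<mu> (- S) = 0 \<and> (\<forall>F. closed F \<and> \<mu> (- F) = 0 \<longrightarrow> S \<subseteq> F)"

text \<open>
  The guard \<open>bounded E\<close> is there because the real-valued \<open>diameter\<close> is meaningful only for
  bounded sets; an unbounded set has infinite diameter, so every \<open>r > 0\<close> is admissible.
\<close>

definition Q_regular_with ::
  "real \<Rightarrow> real \<Rightarrow> real \<Rightarrow> 'a::euclidean_space set \<Rightarrow> bool" where
  "Q_regular_with Q \<alpha> \<beta> E \<longleftrightarrow>
     0 < Q \<and> Q < real DIM('a) \<and> 0 < \<alpha> \<and> \<alpha> \<le> \<beta> \<and>
     (\<exists>\<mu>. borel_regular_outer_measure \<mu> \<and> is_spt \<mu> E \<and>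
        (\<forall>x\<in>E. \<forall>r. 0 < r \<and> (bounded E \<longrightarrow> r < diameter E) \<longrightarrow>
           ennreal (\<alpha> * r powr Q) \<le> \<mu> (ball x r) \<and>
           \<mu> (ball x r) \<le> ennreal (\<beta> * r powr Q)))"

text \<open>
  Since \<open>infdist x {} = 0\<close>, the empty set gets the whole space as neighbourhood; no radius
  \<open>0 < r < diameter {}\<close> exists in that case.
\<close>

definition closed_nbhd :: "'a::metric_space set \<Rightarrow> real \<Rightarrow> 'a set" where
  "closed_nbhd E r = {x. infdist x E \<le> r}"

end

theory Submission
  imports Defs
begin

text \<open>
  A maximal \<open>s\<close>-separated subset of \<open>E\<close> consists of centres of balls of radius \<open>s\<close> that cover
  \<open>E\<close>, while the concentric balls of radius \<open>s/2\<close> are disjoint.  Comparing both families with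
  the regular measure shows that for \<open>s = r\<close> the number of centres is comparable to
  \<open>r powr - Q\<close>, and Lebesgue measure then turns this count into the two volume estimates.  The
  total mass that enters the comparison is controlled from above by the case \<open>s = D/2\<close>, \<open>D = diameter E\<close>, where
  the number of centres is bounded because they all lie in one ball of radius \<open>D\<close>.
\<close>

section \<open>Separated sets and maximal nets\<close>

text \<open>The weak inequality fits open balls on both sides: it already makes the balls of radius
  \<open>s / 2\<close> disjoint, and its failure puts a point into an open ball of radius
  \<open>s\<close>.\<close>

definition separated :: "real \<Rightarrow> 'a::metric_space set \<Rightarrow> bool" where
  "separated s P \<longleftrightarrow> (\<forall>x\<in>P. \<forall>y\<in>P. x \<noteq> y \<longrightarrow> s \<le> dist x y)"

lemma disjoint_balls_separated:
  assumes "separated s P"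
  shows "disjoint_family_on (\<lambda>p. ball p (s / 2)) P"
  unfolding disjoint_family_on_def
proof (intro ballI impI equals0I)
  fix p q z
  assume "p \<in> P" "q \<in> P" "p \<noteq> q" and z: "z \<in> ball p (s / 2) \<inter> ball q (s / 2)"
  with assms have "s \<le> dist p q"
    by (auto simp: separated_def)
  also have "dist p q \<le> dist p z + dist q z"
    by (rule dist_triangle2)
  finally show False
    using z by simp
qed

text \<open>By compactness finitely many balls of radius \<open>s / 2\<close> cover
  \<open>E\<close>, and each contains at most one point of a separated set. This bounds the
  cardinalities, so a largest separated set exists; a point of \<open>E\<close> outside its
  \<open>s\<close>-balls could be added to it.\<close>

lemma compact_separated_net:
  fixes E :: "'a::metric_space set"
  assumes "compact E" "0 < s"
  obtains P where "finite P" "P \<subseteq> E" "separated s P" "E \<subseteq> (\<Union>p\<in>P. ball p s)"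
proof -
  have cover: "E \<subseteq> (\<Union>k\<in>E. ball k (s / 2))"
    using assms(2) by force
  obtain K where K: "K \<subseteq> E" "finite K" "E \<subseteq> (\<Union>k\<in>K. ball k (s / 2))"
    by (rule compactE_image[OF assms(1) open_ball cover])
  define R where "R P \<longleftrightarrow> finite P \<and> P \<subseteq> E \<and> separated s P" for P
  have bound: "card P \<le> card K" if "R P" for P
  proof -
    have "\<forall>p\<in>P. \<exists>k\<in>K. p \<in> ball k (s / 2)"
      using that K(3) by (fastforce simp: R_def)
    then obtain f where f: "\<And>p. p \<in> P \<Longrightarrow> f p \<in> K \<and> p \<in> ball (f p) (s / 2)"
      by metis
    have "inj_on f P"
    proof (rule inj_onI, rule ccontr)
      fix p q assume pq: "p \<in> P" "q \<in> P" "f p = f q" "p \<noteq> q"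
      then have "s \<le> dist p q"
        using that by (auto simp: R_def separated_def)
      moreover have "dist p q \<le> dist (f p) p + dist (f p) q"
        by (rule dist_triangle3)
      ultimately show False
        using f[OF pq(1)] f[OF pq(2)] pq(3) by simp
    qed
    then show ?thesis
      using f K(2) by (intro card_inj_on_le) auto
  qed
  have "R {}"
    by (simp add: R_def separated_def)
  then have "\<exists>P. R P \<and> (\<forall>P'. R P' \<longrightarrow> card P' \<le> card P)"
    by (rule ex_has_greatest_nat[where b = "Suc (card K)"]) (use bound in \<open>simp add: less_Suc_eq_le\<close>)
  then obtain P where P: "R P" "\<And>P'. R P' \<Longrightarrow> card P' \<le> card P"
    by blast
  have "E \<subseteq> (\<Union>p\<in>P. ball p s)"
  proof (rule ccontr)
    assume "\<not> ?thesis"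
    then obtain x where x: "x \<in> E" "\<And>p. p \<in> P \<Longrightarrow> s \<le> dist p x"
      by force
    then have "x \<notin> P"
      using \<open>0 < s\<close> by force
    moreover have "R (insert x P)"
      using P(1) x by (auto simp: R_def separated_def dist_commute)
    ultimately show False
      using P(1) P(2)[of "insert x P"] by (simp add: R_def)
  qed
  with P(1) show ?thesis
    by (intro that[of P]) (simp_all add: R_def)
qed

section \<open>Counting by packing and by covering\<close>

text \<open>The measure is left general because the count is needed for Lebesgue measure and for the
  regular measure; the same holds for the covering bound that follows.\<close>

lemma card_packing_le:
  assumes "finite P" "disjoint_family_on B P" "A \<in> sets M"
    and "\<And>p. p \<in> P \<Longrightarrow> B p \<in> sets M \<and> B p \<subseteq> A \<and> ennreal a \<le> emeasure M (B p)"
    and "0 \<le> a"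
  shows "ennreal (real (card P) * a) \<le> emeasure M A"
proof -
  have "ennreal (real (card P) * a) = (\<Sum>p\<in>P. ennreal a)"
    using assms by (simp add: ennreal_mult ennreal_of_nat_eq_real_of_nat)
  also have "\<dots> \<le> (\<Sum>p\<in>P. emeasure M (B p))"
    using assms by (intro sum_mono) auto
  also have "\<dots> = emeasure M (\<Union>p\<in>P. B p)"
    using assms by (intro sum_emeasure) auto
  also have "\<dots> \<le> emeasure M A"
    using assms by (intro emeasure_mono) auto
  finally show ?thesis .
qed

lemma emeasure_cover_le:
  assumes "finite P" "A \<subseteq> (\<Union>p\<in>P. B p)"
    and "\<And>p. p \<in> P \<Longrightarrow> B p \<in> sets M \<and> emeasure M (B p) \<le> ennreal b"
    and "0 \<le> b"
  shows "emeasure M A \<le> ennreal (real (card P) * b)"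
proof -
  have "emeasure M A \<le> emeasure M (\<Union>p\<in>P. B p)"
    using assms by (intro emeasure_mono) auto
  also have "\<dots> \<le> (\<Sum>p\<in>P. emeasure M (B p))"
    using assms by (intro emeasure_subadditive_finite) auto
  also have "\<dots> \<le> (\<Sum>p\<in>P. ennreal b)"
    using assms by (intro sum_mono) auto
  also have "\<dots> = ennreal (real (card P) * b)"
    using assms by (simp add: ennreal_mult ennreal_of_nat_eq_real_of_nat)
  finally show ?thesis .
qed

section \<open>From outer measures to Borel measures\<close>

text \<open>By Caratheodory's theorem an outer measure is countably additive on its measurable sets,
  and these include the Borel sets.\<close>

lemma borel_regular_outer_measure_obtain_measure:
  fixes \<mu> :: "'a::topological_space set \<Rightarrow> ennreal"
  assumes "borel_regular_outer_measure \<mu>"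
  obtains N where "sets N = sets borel" "\<And>A. A \<in> sets borel \<Longrightarrow> emeasure N A = \<mu> A"
proof -
  \<comment> \<open>As a family of sets, \<open>UNIV\<close> is the full power set, the domain of
    the outer measure.\<close>
  interpret sigma_algebra "UNIV :: 'a set" UNIV
    using sigma_algebra_Pow[of "UNIV :: 'a set"] by simp
  have oms: "outer_measure_space UNIV \<mu>" and sub: "sets borel \<subseteq> lambda_system UNIV UNIV \<mu>"
    using assms by (auto simp: borel_regular_outer_measure_def)
  have "measure_space UNIV (lambda_system UNIV UNIV \<mu>) \<mu>"
    by (rule caratheodory_lemma[OF oms])
  then have pos: "positive (sets borel) \<mu>" and ca: "countably_additive (sets borel) \<mu>"
    using sub by (auto simp: measure_space_def positive_def countably_additive_def subset_iff)
  have sa: "sigma_algebra (UNIV :: 'a set) (sets borel)"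
    using sets.sigma_algebra_axioms[of "borel :: 'a measure"] by simp
  show ?thesis
  proof (rule that)
    show "sets (measure_of UNIV (sets borel) \<mu>) = sets (borel :: 'a measure)"
      using sigma_algebra.sets_measure_of_eq[OF sa] by blast
    show "emeasure (measure_of UNIV (sets borel) \<mu>) A = \<mu> A" if "A \<in> sets borel" for A
      by (rule emeasure_measure_of_sigma[OF sa pos ca that])
  qed
qed

text \<open>Balls and the complement of the closed set \<open>E\<close> are open, so the outer
  measure and its Borel restriction agree on every set that matters here.\<close>

lemma Q_regular_with_obtain_measure:
  fixes E :: "'a::euclidean_space set"
  assumes "Q_regular_with Q \<alpha> \<beta> E" "bounded E"
  obtains N where "sets N = sets borel" "emeasure N (- E) = 0"
    "\<And>x r. x \<in> E \<Longrightarrow> 0 < r \<Longrightarrow> r < diameter E \<Longrightarrow> ennreal (\<alpha> * r powr Q) \<le> emeasure N (ball x r)"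
    "\<And>x r. x \<in> E \<Longrightarrow> 0 < r \<Longrightarrow> r < diameter E \<Longrightarrow> emeasure N (ball x r) \<le> ennreal (\<beta> * r powr Q)"
proof -
  from assms obtain \<mu> where \<mu>: "borel_regular_outer_measure \<mu>" "is_spt \<mu> E"
    "\<And>x r. x \<in> E \<Longrightarrow> 0 < r \<Longrightarrow> r < diameter E \<Longrightarrow> ennreal (\<alpha> * r powr Q) \<le> \<mu> (ball x r)"
    "\<And>x r. x \<in> E \<Longrightarrow> 0 < r \<Longrightarrow> r < diameter E \<Longrightarrow> \<mu> (ball x r) \<le> ennreal (\<beta> * r powr Q)"
    unfolding Q_regular_with_def by blast
  obtain N where N: "sets N = sets borel" "\<And>A. A \<in> sets borel \<Longrightarrow> emeasure N A = \<mu> A"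
    using borel_regular_outer_measure_obtain_measure[OF \<mu>(1)] by blast
  have "closed E" "\<mu> (- E) = 0"
    using \<mu>(2) by (auto simp: is_spt_def)
  then have "emeasure N (- E) = 0"
    by (subst N(2)) (auto intro: borel_closed borel_comp)
  with \<mu> N that show ?thesis
    by auto
qed

lemma emeasure_null_compl:
  assumes "space M = UNIV" "A \<in> sets M" "emeasure M (- A) = 0"
  shows "emeasure M A = emeasure M UNIV"
proof -
  have "- A \<in> null_sets M"
    using assms sets.compl_sets[OF assms(2)] by (auto simp: null_sets_def Compl_eq_Diff_UNIV)
  from emeasure_Un_null_set[OF assms(2) this] show ?thesis
    by simp
qed

section \<open>Volume of closed neighbourhoods\<close>

lemma closed_nbhd_closed: "closed (closed_nbhd E r)"
  unfolding closed_nbhd_def by (intro closed_Collect_le continuous_intros)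

text \<open>Closedness provides a nearest point of \<open>E\<close>, at distance at most
  \<open>r\<close>; that point is within \<open>s\<close> of some centre.\<close>

lemma closed_nbhd_subset_cballs:
  fixes E :: "'a::heine_borel set"
  assumes "closed E" "E \<noteq> {}" "E \<subseteq> (\<Union>p\<in>P. ball p s)"
  shows "closed_nbhd E r \<subseteq> (\<Union>p\<in>P. cball p (s + r))"
proof
  fix x assume "x \<in> closed_nbhd E r"
  then have "infdist x E \<le> r"
    by (simp add: closed_nbhd_def)
  moreover obtain y where "y \<in> E" "infdist x E = dist x y"
    using infdist_attains_inf[OF assms(1,2)] by blast
  moreover from this assms(3) obtain p where "p \<in> P" "dist p y < s"
    by auto
  moreover have "dist p x \<le> dist p y + dist x y"
    by (rule dist_triangle2)
  ultimately show "x \<in> (\<Union>p\<in>P. cball p (s + r))"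
    by force
qed

text \<open>The constants are explicit in the regularity data, so that they can be chosen before
  \<open>E\<close>. The last factors \<open>2 ^ n\<close> come from the radii \<open>r / 2\<close>
  of the packed balls and \<open>2 * r\<close> of the covering balls.\<close>

lemma closed_nbhd_estimates:
  fixes E :: "'a::euclidean_space set"
  assumes E: "compact E" "Q_regular_with Q \<alpha> \<beta> E" and r: "0 < r" "r < diameter E"
  defines "D \<equiv> diameter E" and "n \<equiv> DIM('a)" and "\<omega> \<equiv> unit_ball_vol (real DIM('a))"
  shows "ennreal (\<alpha> * (D / 2) powr Q / \<beta> * \<omega> / 2 ^ n * r powr (real n - Q))
           \<le> emeasure lebesgue (closed_nbhd E r)"
    and "emeasure lebesgue (closed_nbhd E r)
           \<le> ennreal (8 ^ n * \<beta> * (D / 2) powr Q * 2 powr Q / \<alpha> * \<omega> * 2 ^ n * r powr (real n - Q))"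
proof -
  have ab: "0 < \<alpha>" "0 < \<beta>"
    using E(2) by (auto simp: Q_regular_with_def)
  have \<omega>: "0 < \<omega>"
    by (simp add: \<omega>_def unit_ball_vol_pos)
  have D: "0 < D" "r < D"
    using r by (auto simp: D_def)
  have bE: "bounded E" and cE: "closed E"
    using E(1) compact_imp_bounded compact_imp_closed by auto
  have "E \<noteq> {}"
    using D by (auto simp: D_def)
  then obtain x0 where x0: "x0 \<in> E"
    by blast
  obtain N where N: "sets N = sets borel" "emeasure N (- E) = 0"
    and low: "\<And>x s. x \<in> E \<Longrightarrow> 0 < s \<Longrightarrow> s < D \<Longrightarrow> ennreal (\<alpha> * s powr Q) \<le> emeasure N (ball x s)"
    and up: "\<And>x s. x \<in> E \<Longrightarrow> 0 < s \<Longrightarrow> s < D \<Longrightarrow> emeasure N (ball x s) \<le> ennreal (\<beta> * s powr Q)"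
    using Q_regular_with_obtain_measure[OF E(2) bE] unfolding D_def by blast
  have spN: "space N = UNIV"
    using sets_eq_imp_space_eq[OF N(1)] by simp
  have NE: "emeasure N E = emeasure N UNIV"
    using emeasure_null_compl[OF spN _ N(2)] cE N(1) by auto
  \<comment> \<open>Covering \<open>E\<close> bounds the total mass, since \<open>N\<close> is
    concentrated on \<open>E\<close>.\<close>
  have mass_le: "emeasure N UNIV \<le> ennreal (real (card P) * (\<beta> * s powr Q))"
    if "finite P" "P \<subseteq> E" "E \<subseteq> (\<Union>p\<in>P. ball p s)" "0 < s" "s < D" for P s
    unfolding NE[symmetric]
    by (rule emeasure_cover_le[OF that(1,3)]) (use that up N ab in auto)

  \<comment> \<open>Regularity speaks only about radii below \<open>D\<close>, so the total mass is
    bounded through balls of radius \<open>D / 2\<close>.\<close>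
  obtain P0 where P0: "finite P0" "P0 \<subseteq> E" "separated (D / 2) P0" "E \<subseteq> (\<Union>p\<in>P0. ball p (D / 2))"
    using compact_separated_net[OF E(1), of "D / 2"] D by auto
  \<comment> \<open>All centres lie within \<open>D\<close> of \<open>x0\<close>, so the balls of
    radius \<open>D / 4\<close> fit into \<open>ball x0 (2 * D)\<close>. The ratio of the radii is
    8, whence at most \<open>8 ^ n\<close> centres.\<close>
  have "ennreal (real (card P0) * (\<omega> * (D / 2 / 2) ^ n)) \<le> emeasure lborel (ball x0 (2 * D))"
  proof (rule card_packing_le[OF P0(1) disjoint_balls_separated[OF P0(3)]])
    fix p assume "p \<in> P0"
    then have "dist x0 p \<le> D"
      unfolding D_def using P0 x0 by (intro diameter_bounded_bound[OF bE]) auto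
    then have "ball p (D / 2 / 2) \<subseteq> ball x0 (2 * D)"
      using D by (intro ball_subset_ball_iff[THEN iffD2]) (auto simp: dist_commute)
    then show "ball p (D / 2 / 2) \<in> sets lborel \<and> ball p (D / 2 / 2) \<subseteq> ball x0 (2 * D) \<and>
        ennreal (\<omega> * (D / 2 / 2) ^ n) \<le> emeasure lborel (ball p (D / 2 / 2))"
      using D emeasure_ball[of "D / 2 / 2" p] by (auto simp: \<omega>_def n_def)
  qed (use D \<omega> in auto)
  also have "\<dots> = ennreal (\<omega> * (2 * D) ^ n)"
    using D by (simp add: emeasure_ball \<omega>_def n_def)
  finally have "real (card P0) * (\<omega> * (D / 2 / 2) ^ n) \<le> \<omega> * (2 * D) ^ n"
    using D \<omega> by (subst (asm) ennreal_le_iff) auto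
  also have "2 * D = 8 * (D / 2 / 2)"
    by simp
  also have "\<omega> * (8 * (D / 2 / 2)) ^ n = 8 ^ n * (\<omega> * (D / 2 / 2) ^ n)"
    by (simp only: power_mult_distrib mult_ac)
  finally have card0: "real (card P0) \<le> 8 ^ n"
    using D \<omega> by (subst (asm) mult_le_cancel_right) auto
  \<comment> \<open>\<open>enn2real\<close> sends infinity to 0, so \<open>m\<close> stands for the
    total mass only once \<open>mass_ub\<close> has shown finiteness.\<close>
  define m where "m = enn2real (emeasure N UNIV)"
  have "emeasure N UNIV \<le> ennreal (real (card P0) * (\<beta> * (D / 2) powr Q))"
    using D by (intro mass_le P0) auto
  also have "\<dots> \<le> ennreal (8 ^ n * (\<beta> * (D / 2) powr Q))"
    using card0 ab by (intro ennreal_leI mult_right_mono) auto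
  finally have mass_ub: "emeasure N UNIV \<le> ennreal (8 ^ n * (\<beta> * (D / 2) powr Q))" .
  then have m: "emeasure N UNIV = ennreal m" "0 \<le> m"
    unfolding m_def using le_less_trans[OF mass_ub ennreal_less_top] by auto
  have m_ub: "m \<le> 8 ^ n * (\<beta> * (D / 2) powr Q)"
    using mass_ub ab unfolding m by (subst (asm) ennreal_le_iff) auto
  have "ennreal (\<alpha> * (D / 2) powr Q) \<le> emeasure N (ball x0 (D / 2))"
    using low x0 D by auto
  also have "\<dots> \<le> emeasure N UNIV"
    using N by (intro emeasure_mono) auto
  finally have m_lb: "\<alpha> * (D / 2) powr Q \<le> m"
    unfolding m using m by (subst (asm) ennreal_le_iff) auto

  obtain P where P: "finite P" "P \<subseteq> E" "separated r P" "E \<subseteq> (\<Union>p\<in>P. ball p r)"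
    using compact_separated_net[OF E(1) r(1)] by blast
  \<comment> \<open>Covering by balls of radius \<open>r\<close> bounds \<open>k\<close> from below,
    packing balls of radius \<open>r / 2\<close> bounds it from above.\<close>
  define k where "k = real (card P)"
  have "ennreal m \<le> ennreal (k * (\<beta> * r powr Q))"
    unfolding k_def m(1)[symmetric] using D r by (intro mass_le P) auto
  then have "m \<le> k * (\<beta> * r powr Q)"
    using ab by (subst (asm) ennreal_le_iff) (auto simp: k_def)
  then have k_lb: "\<alpha> * (D / 2) powr Q / (\<beta> * r powr Q) \<le> k"
    using m_lb ab r by (simp add: divide_le_eq)
  have "ennreal (k * (\<alpha> * (r / 2) powr Q)) \<le> emeasure N UNIV"
    unfolding k_def
    by (rule card_packing_le[OF P(1) disjoint_balls_separated[OF P(3)]])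
       (use N low P D r ab spN in \<open>auto simp: sets.top[of N, unfolded spN]\<close>)
  then have "k * (\<alpha> * (r / 2) powr Q) \<le> m"
    unfolding m using m by (subst (asm) ennreal_le_iff) auto
  then have k_ub: "k \<le> 8 ^ n * (\<beta> * (D / 2) powr Q) / (\<alpha> * (r / 2) powr Q)"
    using m_ub ab r by (simp add: le_divide_eq)

  have meas: "closed_nbhd E r \<in> sets borel"
    by (intro borel_closed closed_nbhd_closed)
  then have leb: "emeasure lebesgue (closed_nbhd E r) = emeasure lborel (closed_nbhd E r)"
    by simp
  have r_powr: "r powr (real n - Q) = r ^ n / r powr Q"
    using r by (simp add: powr_diff powr_realpow)

  have "\<alpha> * (D / 2) powr Q / \<beta> * \<omega> / 2 ^ n * r powr (real n - Q)
      = \<alpha> * (D / 2) powr Q / (\<beta> * r powr Q) * (\<omega> * (r / 2) ^ n)"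
    unfolding r_powr by (simp add: power_divide mult_ac)
  also have "\<dots> \<le> k * (\<omega> * (r / 2) ^ n)"
    using k_lb \<omega> r by (intro mult_right_mono) auto
  finally have "ennreal (\<alpha> * (D / 2) powr Q / \<beta> * \<omega> / 2 ^ n * r powr (real n - Q))
      \<le> ennreal (k * (\<omega> * (r / 2) ^ n))"
    by (rule ennreal_leI)
  also have "\<dots> \<le> emeasure lborel (closed_nbhd E r)"
    unfolding k_def
  proof (rule card_packing_le[OF P(1) disjoint_balls_separated[OF P(3)]])
    fix p assume "p \<in> P"
    with P have "infdist x E \<le> dist x p" for x
      by (intro infdist_le) auto
    then have "ball p (r / 2) \<subseteq> closed_nbhd E r"
      using r by (force simp: closed_nbhd_def dist_commute intro: order_trans)
    then show "ball p (r / 2) \<in> sets lborel \<and> ball p (r / 2) \<subseteq> closed_nbhd E r \<and>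
        ennreal (\<omega> * (r / 2) ^ n) \<le> emeasure lborel (ball p (r / 2))"
      using r emeasure_ball[of "r / 2" p] by (auto simp: \<omega>_def n_def)
  qed (use meas \<omega> r in auto)
  finally show "ennreal (\<alpha> * (D / 2) powr Q / \<beta> * \<omega> / 2 ^ n * r powr (real n - Q))
      \<le> emeasure lebesgue (closed_nbhd E r)"
    unfolding leb .

  \<comment> \<open>The net has scale \<open>r\<close>, so enlarging its balls by \<open>r\<close>
    gives the radius \<open>r + r\<close>.\<close>
  have "emeasure lborel (closed_nbhd E r) \<le> ennreal (k * (\<omega> * (r + r) ^ n))"
    unfolding k_def
    by (rule emeasure_cover_le[OF P(1) closed_nbhd_subset_cballs[OF cE \<open>E \<noteq> {}\<close> P(4)]])
       (use \<omega> r in \<open>auto simp: emeasure_cball \<omega>_def n_def\<close>)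
  also have "\<dots> \<le> ennreal (8 ^ n * (\<beta> * (D / 2) powr Q) / (\<alpha> * (r / 2) powr Q) * (\<omega> * (r + r) ^ n))"
    using k_ub \<omega> r by (intro ennreal_leI mult_right_mono) auto
  also have "8 ^ n * (\<beta> * (D / 2) powr Q) / (\<alpha> * (r / 2) powr Q) * (\<omega> * (r + r) ^ n)
      = 8 ^ n * \<beta> * (D / 2) powr Q * 2 powr Q / \<alpha> * \<omega> * 2 ^ n * r powr (real n - Q)"
    unfolding r_powr mult_2[symmetric] using r
    by (simp add: powr_divide power_mult_distrib mult_ac)
  finally show "emeasure lebesgue (closed_nbhd E r)
      \<le> ennreal (8 ^ n * \<beta> * (D / 2) powr Q * 2 powr Q / \<alpha> * \<omega> * 2 ^ n * r powr (real n - Q))"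
    unfolding leb .
qed

section \<open>Constants depending only on the data\<close>

text \<open>Dependence on the data alone is expressed by the order of quantifiers: \<open>c\<close>
  and \<open>C\<close> are chosen for given dimension, \<open>Q\<close>, \<alpha>, \<beta> and
  \<open>D\<close>, before \<open>E\<close>.\<close>

theorem lemma4p4:
  fixes Q \<alpha> \<beta> D :: real
  assumes "CARD('n::finite) \<ge> 2" and "0 < Q" and "Q < real CARD('n)"
  shows "\<exists>c C :: real. 0 < c \<and> c < C \<and>
    (\<forall>E :: (real ^ 'n) set.
       compact E \<and> Q_regular_with Q \<alpha> \<beta> E \<and> diameter E = D \<longrightarrow>
       (\<forall>r. 0 < r \<and> r < diameter E \<longrightarrow>
          ennreal (c * r powr (real CARD('n) - Q)) \<le> emeasure lebesgue (closed_nbhd E r) \<and>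
          emeasure lebesgue (closed_nbhd E r) \<le> ennreal (C * r powr (real CARD('n) - Q))))"
proof (cases "0 < D \<and> 0 < \<alpha> \<and> \<alpha> \<le> \<beta>")
  case True
  define n where "n = CARD('n)"
  define \<omega> where "\<omega> = unit_ball_vol (real n)"
  define c where "c = \<alpha> * (D / 2) powr Q / \<beta> * \<omega> / 2 ^ n"
  define C where "C = 8 ^ n * \<beta> * (D / 2) powr Q * 2 powr Q / \<alpha> * \<omega> * 2 ^ n"
  have pos: "0 < c" "0 < C"
    using True by (auto simp: c_def C_def \<omega>_def unit_ball_vol_pos)
  have "ennreal (c * r powr (real CARD('n) - Q)) \<le> emeasure lebesgue (closed_nbhd E r) \<and>
        emeasure lebesgue (closed_nbhd E r) \<le> ennreal ((c + C) * r powr (real CARD('n) - Q))"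
    if "compact E" "Q_regular_with Q \<alpha> \<beta> E" "diameter E = D" "0 < r" "r < diameter E"
    for E :: "(real ^ 'n) set" and r
  proof -
    have "ennreal (C * r powr (real n - Q)) \<le> ennreal ((c + C) * r powr (real n - Q))"
      using pos by (intro ennreal_leI mult_right_mono) auto
    with closed_nbhd_estimates[OF that(1,2,4,5)] show ?thesis
      unfolding that(3) c_def C_def \<omega>_def n_def by (auto intro: order_trans)
  qed
  \<comment> \<open>Enlarging the upper constant to \<open>c + C\<close> secures the strict
    inequality between the two constants.\<close>
  with pos show ?thesis
    by (intro exI[of _ c] exI[of _ "c + C"]) auto
next
  \<comment> \<open>Either no set is regular with these constants or no radius is admissible, so any
    pair of constants works.\<close>
  case False
  have "\<not> (Q_regular_with Q \<alpha> \<beta> E \<and> diameter E = D \<and> 0 < r \<and> r < diameter E)"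
    for E :: "(real ^ 'n) set" and r
    using False by (auto simp: Q_regular_with_def)
  then show ?thesis
    by (intro exI[of _ 1] exI[of _ 2]) auto
qed

end
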